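(* Let $\Delta t>0$ and let $\phi^{n-1},\phi^n$ be given, with $\widehat{\phi}^{n+\frac12}=\frac32\phi^n-\frac12\phi^{n-1}$. Suppose $\phi^{n+1}$, $\mu^{n+\frac12}$ and the real number $\mathcal{P}(\eta^{n+\frac12})$ satisfy the second-order Crank-Nicolson zero-factor scheme $$\frac{\phi^{n+1}-\phi^n}{\Delta t}=-\mathcal{G}\mu^{n+\frac12},$$ $$\mu^{n+\frac12}=\tfrac12\mathcal{L}\phi^{n+1}+\tfrac12\mathcal{L}\phi^{n}+F'(\widehat{\phi}^{n+\frac12})+\mathcal{P}(\eta^{n+\frac12})F'(\widehat{\phi}^{n+\frac12}),$$ $$(F(\phi^{n+1}),1)-(F(\phi^{n}),1)=\left(F'(\widehat{\phi}^{n+\frac12}),\phi^{n+1}-\phi^n\right)+\mathcal{P}(\eta^{n+\frac12})\left(F'(\widehat{\phi}^{n+\frac12}),\phi^{n+1}-\phi^n\right).$$ Then the original energy $\mathcal{E}(\phi)=\frac12(\mathcal{L}\phi,\phi)+(F(\phi),1)$ satisfies $$\mathcal{E}(\phi^{n+1})-\mathcal{E}(\phi^{n})=-\Delta t\,(\mathcal{G}\mu^{n+\frac12},\mu^{n+\frac12})\leq0 .$$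
   Context: $(\cdot,\cdot)$ is the $L^2(\Omega)$ inner product (e.g. on a periodic domain $\Omega$). $\mathcal{L}$ is a symmetric non-negative linear operator, $\mathcal{G}$ is a positive linear operator in the sense that $(\mathcal{G}v,v)\ge 0$ for all $v$ (e.g. $\mathcal{G}=I$ or $\mathcal{G}=-\Delta$), $F$ is a differentiable real function (the nonlinear energy density), applied pointwise, and $(F(\phi),1)=\int_\Omega F(\phi)\,d\mathbf{x}$. All functions are assumed regular enough for every expression to be defined. $\mathcal{P}(\eta)$, the "zero factor", is a linear function of a scalar auxiliary variable $\eta(t)$, e.g. $\mathcal{P}(\eta)=k_1\eta$ or $\mathcal{P}(\eta)=k_2\eta_t$ with non-zero constants $k_1,k_2$; $\mathcal{P}(\eta^{n+\frac12})$ is a real number depending on the time step but not on $\mathbf{x}$. *)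

theory Defs
  imports "HOL-Analysis.Analysis"
begin

text \<open>Functions are representatives defined on the whole ambient space; only their values
  almost everywhere on \<open>\<Omega>\<close> matter. A periodic domain is the case where \<open>\<Omega>\<close> is a period
  cell and periodicity is built into the domains of the operators.\<close>

definition L2 :: "'a::euclidean_space set \<Rightarrow> ('a \<Rightarrow> real) set" where
  "L2 \<Omega> = {u \<in> borel_measurable (lebesgue_on \<Omega>). integrable (lebesgue_on \<Omega>) (\<lambda>x. (u x)\<^sup>2)}"

definition L2_inner :: "'a::euclidean_space set \<Rightarrow> ('a \<Rightarrow> real) \<Rightarrow> ('a \<Rightarrow> real) \<Rightarrow> real" where
  "L2_inner \<Omega> u v = (LINT x|lebesgue_on \<Omega>. u x * v x)"

text \<open>Operators such as \<open>-\<Delta>\<close> are unbounded, so an operator \<open>T\<close> carries a domain \<open>D\<close>, a linear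
  subspace of \<open>L2 \<Omega>\<close>. Linearity is required up to null sets, which covers both operators
  acting on classical functions and operators on \<open>L\<^sup>2\<close> classes.\<close>

definition linear_operator_on ::
  "'a::euclidean_space set \<Rightarrow> ('a \<Rightarrow> real) set \<Rightarrow> (('a \<Rightarrow> real) \<Rightarrow> ('a \<Rightarrow> real)) \<Rightarrow> bool" where
  "linear_operator_on \<Omega> D T \<longleftrightarrow>
     D \<subseteq> L2 \<Omega> \<and> (\<lambda>x. 0) \<in> D \<and>
     (\<forall>u\<in>D. \<forall>v\<in>D. \<forall>a b. (\<lambda>x. a * u x + b * v x) \<in> D) \<and>
     (\<forall>u\<in>D. T u \<in> L2 \<Omega>) \<and>
     (\<forall>u\<in>D. \<forall>v\<in>D. \<forall>a b.
        AE x in lebesgue_on \<Omega>. T (\<lambda>x. a * u x + b * v x) x = a * T u x + b * T v x)"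

definition symmetric_operator_on ::
  "'a::euclidean_space set \<Rightarrow> ('a \<Rightarrow> real) set \<Rightarrow> (('a \<Rightarrow> real) \<Rightarrow> ('a \<Rightarrow> real)) \<Rightarrow> bool" where
  "symmetric_operator_on \<Omega> D T \<longleftrightarrow> (\<forall>u\<in>D. \<forall>v\<in>D. L2_inner \<Omega> (T u) v = L2_inner \<Omega> u (T v))"

definition nonneg_operator_on ::
  "'a::euclidean_space set \<Rightarrow> ('a \<Rightarrow> real) set \<Rightarrow> (('a \<Rightarrow> real) \<Rightarrow> ('a \<Rightarrow> real)) \<Rightarrow> bool" where
  "nonneg_operator_on \<Omega> D T \<longleftrightarrow> (\<forall>v\<in>D. L2_inner \<Omega> (T v) v \<ge> 0)"

definition energy ::
  "'a::euclidean_space set \<Rightarrow> (('a \<Rightarrow> real) \<Rightarrow> ('a \<Rightarrow> real)) \<Rightarrow> (real \<Rightarrow> real) \<Rightarrow> ('a \<Rightarrow> real) \<Rightarrow> real" where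
  "energy \<Omega> L F \<phi> = 1/2 * L2_inner \<Omega> (L \<phi>) \<phi> + L2_inner \<Omega> (\<lambda>x. F (\<phi> x)) (\<lambda>x. 1)"

text \<open>In the zero-factor scheme, the value of the zero factor is \<open>P \<eta>\<close> for a linear functional
  \<open>P\<close> on the discrete data \<open>\<eta>\<close> of the auxiliary variable at the half step. The type of \<open>\<eta>\<close> is
  left open, since \<open>k\<^sub>1 \<eta>\<close> needs one real number whereas a discretised \<open>k\<^sub>2 \<eta>\<^sub>t\<close> needs, e.g.,
  the pair of values at two time levels.\<close>

end

theory Submission imports Defs begin

text \<open>Put \<open>d = \<phi>_next - \<phi>\<close>. Testing the first equation with
  \<open>\<mu>\<close> and the second with \<open>d\<close> expresses the same quantity
  \<open>(\<mu>, d)\<close> twice: once as the dissipation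
  \<open>-\<Delta>t (G \<mu>, \<mu>)\<close>, once as a quadratic part plus
  \<open>(1 + P \<eta>) (F'(\<phi>_hat), d)\<close>. Since \<open>L\<close> is averaged over the two
  time levels and is symmetric, the quadratic part telescopes exactly. The third equation says that
  the nonlinear part is exactly the increment of \<open>(F(\<phi>), 1)\<close>, so no Taylor
  remainder has to be estimated. The sign comes from \<open>\<Delta>t > 0\<close> and the positivity
  of \<open>G\<close>. What remains is to justify splitting the integrals:
  \<open>L2_mult_integrable\<close> makes products of \<open>L2\<close> functions integrable, and
  \<open>L2_inner_diff_right\<close> gives the linearity that the telescoping uses.\<close>

lemma L2_mult_integrable:
  assumes "u \<in> L2 \<Omega>" and "v \<in> L2 \<Omega>"
  shows "integrable (lebesgue_on \<Omega>) (\<lambda>x. u x * v x)"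
proof (rule Bochner_Integration.integrable_bound)
  show "integrable (lebesgue_on \<Omega>) (\<lambda>x. (u x)\<^sup>2 + (v x)\<^sup>2)"
    using assms by (auto simp: L2_def)
  show "(\<lambda>x. u x * v x) \<in> borel_measurable (lebesgue_on \<Omega>)"
    using assms by (auto simp: L2_def)
  have "\<bar>a * b\<bar> \<le> a\<^sup>2 + b\<^sup>2" for a b :: real
    using sum_squares_bound[of "\<bar>a\<bar>" "\<bar>b\<bar>"] abs_ge_zero[of "a * b"]
    unfolding abs_mult power2_abs by linarith
  then show "AE x in lebesgue_on \<Omega>. norm (u x * v x) \<le> norm ((u x)\<^sup>2 + (v x)\<^sup>2)"
    by simp
qed

lemma L2_inner_commute: "L2_inner \<Omega> u v = L2_inner \<Omega> v u"
  by (simp add: L2_inner_def mult.commute)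

lemma L2_inner_diff_right:
  assumes "u \<in> L2 \<Omega>" and "v \<in> L2 \<Omega>" and "w \<in> L2 \<Omega>"
  shows "L2_inner \<Omega> u (\<lambda>x. v x - w x) = L2_inner \<Omega> u v - L2_inner \<Omega> u w"
  using assms by (simp add: L2_inner_def right_diff_distrib L2_mult_integrable)

theorem mainTheorem1:
  fixes \<Omega> :: "'a::euclidean_space set"
    and L G :: "('a \<Rightarrow> real) \<Rightarrow> ('a \<Rightarrow> real)"
    and D\<^sub>L D\<^sub>G :: "('a \<Rightarrow> real) set"
    and F :: "real \<Rightarrow> real"
    and P :: "'e::real_vector \<Rightarrow> real" and \<eta> :: 'e
    and \<Delta>t :: real
    and \<phi>_prev \<phi> \<phi>_next \<phi>_hat \<mu> :: "'a \<Rightarrow> real"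
  assumes "\<Omega> \<in> sets lebesgue"
    and "linear_operator_on \<Omega> D\<^sub>L L" and "symmetric_operator_on \<Omega> D\<^sub>L L"
    and "nonneg_operator_on \<Omega> D\<^sub>L L"
    and "linear_operator_on \<Omega> D\<^sub>G G" and "nonneg_operator_on \<Omega> D\<^sub>G G"
    and "\<forall>s. F differentiable (at s)"
    and "linear P"
    and "\<Delta>t > 0"
    and "\<phi>_hat = (\<lambda>x. 3/2 * \<phi> x - 1/2 * \<phi>_prev x)"
    and "\<phi> \<in> D\<^sub>L" and "\<phi>_next \<in> D\<^sub>L" and "\<mu> \<in> D\<^sub>G"
    and "integrable (lebesgue_on \<Omega>) (\<lambda>x. F (\<phi> x))"
    and "integrable (lebesgue_on \<Omega>) (\<lambda>x. F (\<phi>_next x))"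
    and "integrable (lebesgue_on \<Omega>) (\<lambda>x. deriv F (\<phi>_hat x) * (\<phi>_next x - \<phi> x))"
    and "AE x in lebesgue_on \<Omega>. (\<phi>_next x - \<phi> x) / \<Delta>t = - G \<mu> x"
    and "AE x in lebesgue_on \<Omega>.
           \<mu> x = 1/2 * L \<phi>_next x + 1/2 * L \<phi> x + deriv F (\<phi>_hat x) + P \<eta> * deriv F (\<phi>_hat x)"
    and "L2_inner \<Omega> (\<lambda>x. F (\<phi>_next x)) (\<lambda>x. 1) - L2_inner \<Omega> (\<lambda>x. F (\<phi> x)) (\<lambda>x. 1) =
           L2_inner \<Omega> (\<lambda>x. deriv F (\<phi>_hat x)) (\<lambda>x. \<phi>_next x - \<phi> x)
           + P \<eta> * L2_inner \<Omega> (\<lambda>x. deriv F (\<phi>_hat x)) (\<lambda>x. \<phi>_next x - \<phi> x)"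
  shows "energy \<Omega> L F \<phi>_next - energy \<Omega> L F \<phi> = - \<Delta>t * L2_inner \<Omega> (G \<mu>) \<mu>
         \<and> - \<Delta>t * L2_inner \<Omega> (G \<mu>) \<mu> \<le> 0"
proof -
  let ?M = "lebesgue_on \<Omega>"
  define d where "d = (\<lambda>x. \<phi>_next x - \<phi> x)"
  define f where "f = (\<lambda>x. deriv F (\<phi>_hat x))"
  have L2: "\<phi> \<in> L2 \<Omega>" "\<phi>_next \<in> L2 \<Omega>" "L \<phi> \<in> L2 \<Omega>" "L \<phi>_next \<in> L2 \<Omega>" "\<mu> \<in> L2 \<Omega>" "G \<mu> \<in> L2 \<Omega>"
    using assms(2,5,11-13) by (auto simp: linear_operator_on_def)
  have sym: "L2_inner \<Omega> (L \<phi>_next) \<phi> = L2_inner \<Omega> (L \<phi>) \<phi>_next"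
    using assms(3,11,12) by (metis L2_inner_commute symmetric_operator_on_def)
  \<comment> \<open>The first two products are expanded into products of \<open>L2\<close>
    functions. For \<open>f\<close> no membership in \<open>L2\<close> is available, so
    integrability of \<open>f x * d x\<close> comes from its own hypothesis.\<close>
  have int: "integrable ?M (\<lambda>x. L \<phi>_next x * d x)" "integrable ?M (\<lambda>x. L \<phi> x * d x)"
    "integrable ?M (\<lambda>x. f x * d x)"
    using assms(16) L2 by (simp_all add: d_def f_def right_diff_distrib L2_mult_integrable)
  \<comment> \<open>Both tests are done pointwise: this is \<open>\<mu> x * d x\<close> written in
    two ways, off the union of the two exceptional null sets.\<close>
  have "AE x in ?M. - \<Delta>t * (G \<mu> x * \<mu> x)
      = 1/2 * (L \<phi>_next x * d x) + 1/2 * (L \<phi> x * d x) + (1 + P \<eta>) * (f x * d x)"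
    using assms(17,18)
  proof eventually_elim
    case (elim x)
    have "d x = - \<Delta>t * G \<mu> x"
      using elim(1) \<open>\<Delta>t > 0\<close> by (simp add: d_def field_simps)
    moreover have "\<mu> x = 1/2 * L \<phi>_next x + 1/2 * L \<phi> x + (1 + P \<eta>) * f x"
      using elim(2) by (simp add: f_def algebra_simps)
    ultimately show ?case
      by (simp add: algebra_simps)
  qed
  \<comment> \<open>Integrability of both sides supplies the measurability needed to integrate an
    almost-everywhere equality.\<close>
  moreover have "integrable ?M (\<lambda>x. - \<Delta>t * (G \<mu> x * \<mu> x))"
    using L2 by (intro integrable_mult_right L2_mult_integrable)
  ultimately have "(LINT x|?M. - \<Delta>t * (G \<mu> x * \<mu> x))
      = (LINT x|?M. 1/2 * (L \<phi>_next x * d x) + 1/2 * (L \<phi> x * d x) + (1 + P \<eta>) * (f x * d x))"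
    using int by (intro integral_cong_AE borel_measurable_integrable
        Bochner_Integration.integrable_add) simp_all
  then have "- \<Delta>t * L2_inner \<Omega> (G \<mu>) \<mu>
      = 1/2 * L2_inner \<Omega> (L \<phi>_next) d + 1/2 * L2_inner \<Omega> (L \<phi>) d + (1 + P \<eta>) * L2_inner \<Omega> f d"
    using int by (simp add: L2_inner_def)
  \<comment> \<open>Expanding \<open>d\<close> leaves the cross terms
    \<open>(L \<phi>_next, \<phi>)\<close> and \<open>(L \<phi>, \<phi>_next)\<close> with opposite
    signs; they cancel by \<open>sym\<close>.\<close>
  also have "1/2 * L2_inner \<Omega> (L \<phi>_next) d + 1/2 * L2_inner \<Omega> (L \<phi>) d
      = 1/2 * L2_inner \<Omega> (L \<phi>_next) \<phi>_next - 1/2 * L2_inner \<Omega> (L \<phi>) \<phi>"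
    using L2 sym by (simp add: d_def L2_inner_diff_right diff_divide_distrib)
  \<comment> \<open>The zero-factor constraint enters here: it turns the linearised nonlinear term
    into the true increment of the nonlinear energy.\<close>
  also have "(1 + P \<eta>) * L2_inner \<Omega> f d
      = L2_inner \<Omega> (\<lambda>x. F (\<phi>_next x)) (\<lambda>x. 1) - L2_inner \<Omega> (\<lambda>x. F (\<phi> x)) (\<lambda>x. 1)"
    using assms(19) by (simp add: d_def f_def distrib_right)
  finally have "energy \<Omega> L F \<phi>_next - energy \<Omega> L F \<phi> = - \<Delta>t * L2_inner \<Omega> (G \<mu>) \<mu>"
    by (simp add: energy_def)
  moreover have "- \<Delta>t * L2_inner \<Omega> (G \<mu>) \<mu> \<le> 0"
    using assms(6,9,13) by (simp add: nonneg_operator_on_def)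
  ultimately show ?thesis
    by simp
qed

end
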